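(* For every $p \geq 1$ there is a constant $C(p)$, depending only on $p$, such that the following holds. Let $\{a_k\}_{k\in\mathbb{Z}}, \{b_k\}_{k\in\mathbb{Z}}, \{c_k\}_{k\in\mathbb{Z}}$ be bounded sequences of complex numbers, let $J=J(a_k,b_k,c_k)$ be the associated Jacobi operator on $l^2(\mathbb{Z})$, and assume that $J-J_0$ is compact. Let $d=\{d_k\}_{k\in\mathbb{Z}}$ be given by $$d_k=\max\big(|a_{k-1}-1|,|a_k-1|,|b_k|,|c_{k-1}-1|,|c_k-1|\big).$$ Then $$\sum_{\lambda \in \sigma_d(J)} \operatorname{dist}(\lambda,[-2,2])^p \leq C(p)\,\|d\|_{l^p}^p.$$
   Context: The Jacobi operator $J=J(a_k,b_k,c_k):l^2(\mathbb{Z})\to l^2(\mathbb{Z})$ is defined by $(Ju)(k)=a_{k-1}u(k-1)+b_ku(k)+c_ku(k+1)$. The free Jacobi operator is $J_0=J(1,0,1)$, i.e. $(J_0u)(k)=u(k-1)+u(k+1)$; its spectrum is $[-2,2]$. $\sigma_d(J)$ is the set of discrete eigenvalues of $J$, i.e. the isolated points of the spectrum that are eigenvalues of finite algebraic multiplicity. In the sum each eigenvalue is counted according to its algebraic multiplicity. $\|d\|_{l^p}^p=\sum_{k\in\mathbb{Z}}|d_k|^p$ (possibly $+\infty$, in which case the inequality is trivial). *)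

theory Defs
  imports "HOL-Analysis.Analysis"
begin

section \<open>The complex sequence space over the integers\<close>

typedef l2Z = "{x :: int \<Rightarrow> complex. (\<lambda>k. (cmod (x k))\<^sup>2) summable_on UNIV}"
  morphisms l2_coord Abs_l2Z
  by (rule exI[of _ "\<lambda>_. 0"]) simp

setup_lifting type_definition_l2Z

lemma square_summable_add:
  fixes x y :: "int \<Rightarrow> complex"
  assumes "(\<lambda>k. (cmod (x k))\<^sup>2) summable_on UNIV" "(\<lambda>k. (cmod (y k))\<^sup>2) summable_on UNIV"
  shows "(\<lambda>k. (cmod (x k + y k))\<^sup>2) summable_on UNIV"
proof (rule summable_on_comparison_test)
  show "(\<lambda>k. 2 * ((cmod (x k))\<^sup>2 + (cmod (y k))\<^sup>2)) summable_on UNIV"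
    by (intro summable_on_cmult_right summable_on_add assms)
  fix k
  have "(cmod (x k + y k))\<^sup>2 \<le> (cmod (x k) + cmod (y k))\<^sup>2"
    by (intro power_mono norm_triangle_ineq norm_ge_zero)
  also have "\<dots> \<le> 2 * ((cmod (x k))\<^sup>2 + (cmod (y k))\<^sup>2)"
    using zero_le_power2[of "cmod (x k) - cmod (y k)"]
    by (simp add: power2_eq_square algebra_simps)
  finally show "(cmod (x k + y k))\<^sup>2 \<le> 2 * ((cmod (x k))\<^sup>2 + (cmod (y k))\<^sup>2)" .
qed simp

lemma square_summable_mult:
  fixes c x :: "int \<Rightarrow> complex"
  assumes "bounded (range c)" "(\<lambda>k. (cmod (x k))\<^sup>2) summable_on UNIV"
  shows "(\<lambda>k. (cmod (c k * x k))\<^sup>2) summable_on UNIV"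
proof -
  obtain B where B: "\<And>k. cmod (c k) \<le> B"
    using assms(1) by (auto simp: bounded_iff)
  show ?thesis
  proof (rule summable_on_comparison_test)
    show "(\<lambda>k. B\<^sup>2 * (cmod (x k))\<^sup>2) summable_on UNIV"
      by (intro summable_on_cmult_right assms)
    show "(cmod (c k * x k))\<^sup>2 \<le> B\<^sup>2 * (cmod (x k))\<^sup>2" for k
      using B[of k] by (simp add: norm_mult power_mult_distrib mult_right_mono power_mono)
  qed simp
qed

lemma square_summable_scale:
  fixes x :: "int \<Rightarrow> complex"
  assumes "(\<lambda>k. (cmod (x k))\<^sup>2) summable_on UNIV"
  shows "(\<lambda>k. (cmod (c * x k))\<^sup>2) summable_on UNIV"
  using square_summable_mult[of "\<lambda>_. c", OF _ assms] by simp

lemma square_summable_shift: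
  fixes x :: "int \<Rightarrow> complex"
  assumes "(\<lambda>k. (cmod (x k))\<^sup>2) summable_on UNIV"
  shows "(\<lambda>k. (cmod (x (k + m)))\<^sup>2) summable_on UNIV"
proof -
  have "bij_betw (\<lambda>k. k + m) UNIV UNIV"
    by (rule bij_betwI[where g = "\<lambda>k. k - m"]) auto
  from summable_on_reindex_bij_betw[OF this, of "\<lambda>k. (cmod (x k))\<^sup>2"] assms
  show ?thesis by simp
qed

lemma summable_inner_square_summable:
  fixes x y :: "int \<Rightarrow> complex"
  assumes "(\<lambda>k. (cmod (x k))\<^sup>2) summable_on UNIV" "(\<lambda>k. (cmod (y k))\<^sup>2) summable_on UNIV"
  shows "(\<lambda>k. inner (x k) (y k)) summable_on UNIV"
proof -
  have eq: "inner (x k) (y k) =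
      1/2 * ((cmod (x k + y k))\<^sup>2 + (- ((cmod (x k))\<^sup>2) + - ((cmod (y k))\<^sup>2)))" for k
    by (simp add: power2_norm_eq_inner inner_add_left inner_add_right inner_commute)
  show ?thesis
    unfolding eq
    by (intro summable_on_cmult_right summable_on_add square_summable_add assms
          summable_on_uminus[THEN iffD2])
qed

instantiation l2Z :: real_inner
begin

lift_definition zero_l2Z :: l2Z is "\<lambda>_. 0" by simp

lift_definition plus_l2Z :: "l2Z \<Rightarrow> l2Z \<Rightarrow> l2Z" is "\<lambda>x y k. x k + y k"
  by (rule square_summable_add)

lift_definition uminus_l2Z :: "l2Z \<Rightarrow> l2Z" is "\<lambda>x k. - x k" by simp

lift_definition minus_l2Z :: "l2Z \<Rightarrow> l2Z \<Rightarrow> l2Z" is "\<lambda>x y k. x k - y k"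
  subgoal for x y using square_summable_add[of x "\<lambda>k. - y k"] by simp
  done

lift_definition scaleR_l2Z :: "real \<Rightarrow> l2Z \<Rightarrow> l2Z" is "\<lambda>r x k. r *\<^sub>R x k"
  by (simp add: scaleR_conv_of_real square_summable_scale del: norm_of_real norm_scaleR)

lift_definition inner_l2Z :: "l2Z \<Rightarrow> l2Z \<Rightarrow> real" is "\<lambda>x y. \<Sum>\<^sub>\<infinity>k. inner (x k) (y k)" .

definition norm_l2Z :: "l2Z \<Rightarrow> real" where
  "norm_l2Z x = sqrt (\<Sum>\<^sub>\<infinity>k. (cmod (l2_coord x k))\<^sup>2)"

definition dist_l2Z :: "l2Z \<Rightarrow> l2Z \<Rightarrow> real" where
  "dist_l2Z x y = norm (x - y)"

definition sgn_l2Z :: "l2Z \<Rightarrow> l2Z" where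
  "sgn_l2Z x = scaleR (inverse (norm x)) x"

definition uniformity_l2Z :: "(l2Z \<times> l2Z) filter" where
  "uniformity_l2Z = (INF e\<in>{0<..}. principal {(x, y). dist x y < e})"

definition open_l2Z :: "l2Z set \<Rightarrow> bool" where
  "open_l2Z U \<longleftrightarrow> (\<forall>x\<in>U. \<forall>\<^sub>F (x', y) in uniformity. x' = x \<longrightarrow> y \<in> U)"

instance
proof
  fix x y z :: l2Z and r s :: real and U :: "l2Z set"
  show "x + y + z = x + (y + z)" by transfer (simp add: add.assoc)
  show "x + y = y + x" by transfer (simp add: add.commute)
  show "0 + x = x" by transfer simp
  show "- x + x = 0" by transfer simp
  show "x - y = x + - y" by transfer simp
  show "r *\<^sub>R (x + y) = r *\<^sub>R x + r *\<^sub>R y" by transfer (simp add: scaleR_right_distrib)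
  show "(r + s) *\<^sub>R x = r *\<^sub>R x + s *\<^sub>R x" by transfer (simp add: scaleR_left_distrib)
  show "r *\<^sub>R s *\<^sub>R x = (r * s) *\<^sub>R x" by transfer simp
  show "1 *\<^sub>R x = x" by transfer simp
  show "sgn x = scaleR (inverse (norm x)) x" by (rule sgn_l2Z_def)
  show "dist x y = norm (x - y)" by (rule dist_l2Z_def)
  show "(uniformity :: (l2Z \<times> l2Z) filter) = (INF e\<in>{0<..}. principal {(x, y). dist x y < e})"
    by (rule uniformity_l2Z_def)
  show "open U \<longleftrightarrow> (\<forall>x\<in>U. \<forall>\<^sub>F (x', y) in uniformity. x' = x \<longrightarrow> y \<in> U)"
    by (rule open_l2Z_def)
  show "inner x y = inner y x" by transfer (simp add: inner_commute)
  show "inner (x + y) z = inner x z + inner y z"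
    by transfer (simp add: inner_add_left infsum_add summable_inner_square_summable)
  show "inner (r *\<^sub>R x) y = r * inner x y"
    by transfer (simp add: infsum_cmult_right')
  show "0 \<le> inner x x" by transfer (simp add: infsum_nonneg)
  show "inner x x = 0 \<longleftrightarrow> x = 0"
  proof transfer
    fix f :: "int \<Rightarrow> complex"
    assume f: "(\<lambda>k. (cmod (f k))\<^sup>2) summable_on UNIV"
    show "((\<Sum>\<^sub>\<infinity>k. inner (f k) (f k)) = 0) = (f = (\<lambda>_. 0))"
    proof
      assume "(\<Sum>\<^sub>\<infinity>k. inner (f k) (f k)) = 0"
      then have "inner (f k) (f k) = 0" for k
        by (intro nonneg_infsum_le_0D[of "\<lambda>k. inner (f k) (f k)" UNIV]
              summable_inner_square_summable f) auto
      then show "f = (\<lambda>_. 0)" by auto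
    qed simp
  qed
  show "norm x = sqrt (inner x x)"
    unfolding norm_l2Z_def by transfer (simp add: power2_norm_eq_inner)
qed

end

lift_definition cscale :: "complex \<Rightarrow> l2Z \<Rightarrow> l2Z" (infixr \<open>*\<^sub>C\<close> 75) is "\<lambda>c x k. c * x k"
  by (rule square_summable_scale)

interpretation l2Z: vector_space cscale
  by unfold_locales (transfer; simp add: algebra_simps)+


section \<open>Spectral notions for operators on the sequence space\<close>

text \<open>
  The notions below are meant for complex-linear bounded operators. The type of the class
  predicate \<^const>\<open>bounded_linear\<close> only records real linearity, but a two-sided inverse of a
  complex-linear map is automatically complex-linear.
\<close>

definition resolvent_set :: "(l2Z \<Rightarrow> l2Z) \<Rightarrow> complex set" where
  "resolvent_set T = {z. \<exists>R. bounded_linear R \<and>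
     (\<forall>u. T (R u) - z *\<^sub>C R u = u) \<and> (\<forall>u. R (T u - z *\<^sub>C u) = u)}"

definition spectrum :: "(l2Z \<Rightarrow> l2Z) \<Rightarrow> complex set" where
  "spectrum T = - resolvent_set T"

definition eigenvalue :: "(l2Z \<Rightarrow> l2Z) \<Rightarrow> complex \<Rightarrow> bool" where
  "eigenvalue T z \<longleftrightarrow> (\<exists>u. u \<noteq> 0 \<and> T u = z *\<^sub>C u)"

definition gen_eigenspace :: "(l2Z \<Rightarrow> l2Z) \<Rightarrow> complex \<Rightarrow> l2Z set" where
  "gen_eigenspace T z = {u. \<exists>n. ((\<lambda>v. T v - z *\<^sub>C v) ^^ n) u = 0}"

text \<open>
  The dimension \<^const>\<open>l2Z.dim\<close> is the complex dimension; it is a natural number and equals \<open>0\<close>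
  for infinite-dimensional spaces, so finiteness is expressed separately.
  The algebraic multiplicity is the dimension of the generalized eigenspace (root space). At an
  isolated point of the spectrum whose Riesz projection has finite rank, the root space is the
  range of that projection, so the multiplicity is then also the rank of the Riesz projection.
\<close>

definition finite_alg_mult :: "(l2Z \<Rightarrow> l2Z) \<Rightarrow> complex \<Rightarrow> bool" where
  "finite_alg_mult T z \<longleftrightarrow> (\<exists>B. finite B \<and> gen_eigenspace T z \<subseteq> l2Z.span B)"

definition alg_mult :: "(l2Z \<Rightarrow> l2Z) \<Rightarrow> complex \<Rightarrow> nat" where
  "alg_mult T z = l2Z.dim (gen_eigenspace T z)"

definition discrete_spectrum :: "(l2Z \<Rightarrow> l2Z) \<Rightarrow> complex set" where
  "discrete_spectrum T =
     {z. z isolated_in spectrum T \<and> eigenvalue T z \<and> finite_alg_mult T z}"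

definition compact_operator :: "('a::real_normed_vector \<Rightarrow> 'b::real_normed_vector) \<Rightarrow> bool" where
  "compact_operator K \<longleftrightarrow>
     bounded_linear K \<and> (\<forall>B. bounded B \<longrightarrow> compact (closure (K ` B)))"


section \<open>Jacobi operators\<close>

text \<open>
  \<^const>\<open>Abs_l2Z\<close> is applied to a square-summable sequence as soon as the coefficients are
  bounded, see \<open>l2_coord_jacobi\<close>; for unbounded coefficients the value carries no meaning.
\<close>

definition jacobi ::
    "(int \<Rightarrow> complex) \<Rightarrow> (int \<Rightarrow> complex) \<Rightarrow> (int \<Rightarrow> complex) \<Rightarrow> l2Z \<Rightarrow> l2Z" where
  "jacobi a b c u = Abs_l2Z (\<lambda>k. a (k - 1) * l2_coord u (k - 1) + b k * l2_coord u k
                                 + c k * l2_coord u (k + 1))"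

lemma l2_coord_jacobi:
  assumes "bounded (range a)" "bounded (range b)" "bounded (range c)"
  shows "l2_coord (jacobi a b c u) k =
    a (k - 1) * l2_coord u (k - 1) + b k * l2_coord u k + c k * l2_coord u (k + 1)"
proof -
  have u: "(\<lambda>k. (cmod (l2_coord u k))\<^sup>2) summable_on UNIV"
    using l2_coord[of u] by simp
  have a: "(\<lambda>k. (cmod (a (k - 1) * l2_coord u (k - 1)))\<^sup>2) summable_on UNIV"
    using square_summable_shift[OF square_summable_mult[OF assms(1) u], of "- 1"] by simp
  have b: "(\<lambda>k. (cmod (b k * l2_coord u k))\<^sup>2) summable_on UNIV"
    by (rule square_summable_mult[OF assms(2) u])
  have c: "(\<lambda>k. (cmod (c k * l2_coord u (k + 1)))\<^sup>2) summable_on UNIV"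
    by (rule square_summable_mult[OF assms(3) square_summable_shift[OF u]])
  show ?thesis
    unfolding jacobi_def
    by (subst Abs_l2Z_inverse)
       (use square_summable_add[OF square_summable_add[OF a b] c] in simp_all)
qed

definition free_jacobi :: "l2Z \<Rightarrow> l2Z" where
  "free_jacobi = jacobi (\<lambda>_. 1) (\<lambda>_. 0) (\<lambda>_. 1)"

definition jacobi_deviation ::
    "(int \<Rightarrow> complex) \<Rightarrow> (int \<Rightarrow> complex) \<Rightarrow> (int \<Rightarrow> complex) \<Rightarrow> int \<Rightarrow> real" where
  "jacobi_deviation a b c k =
     Max {cmod (a (k - 1) - 1), cmod (a k - 1), cmod (b k), cmod (c (k - 1) - 1), cmod (c k - 1)}"

end

theory Submission
  imports Defs
begin

text \<open>
  On a finite sum of root spaces of \<open>J\<close>, a Schur triangularization yields a finite orthonormal set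
  \<open>E\<close> for which the numbers \<open>\<langle>J e, e\<rangle>\<close> run through the chosen eigenvalues with multiplicity. As
  \<open>\<langle>J\<^sub>0 e, e\<rangle>\<close> lies in the numerical range \<open>[-2, 2]\<close>, the distance of \<open>\<langle>J e, e\<rangle>\<close> to this interval
  is at most \<open>\<bar>\<langle>(J - J\<^sub>0) e, e\<rangle>\<bar> \<le> 3 (\<Sum>k. d\<^sub>k \<bar>e\<^sub>k\<bar>\<^sup>2)\<close>. The weights \<open>\<bar>e\<^sub>k\<bar>\<^sup>2\<close> have total mass \<open>1\<close>,
  so Jensen's inequality bounds the \<open>p\<close>-th power by \<open>3\<^sup>p (\<Sum>k. d\<^sub>k\<^sup>p \<bar>e\<^sub>k\<bar>\<^sup>2)\<close>, and
  \<open>(\<Sum>e\<in>E. \<bar>e\<^sub>k\<bar>\<^sup>2) \<le> 1\<close> by Bessel's inequality; hence \<open>C = 3\<^sup>p\<close>.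
\<close>

section \<open>The complex inner product\<close>

text \<open>Linear in the first argument, conjugate-linear in the second. The
  \<open>real_inner\<close> instance supplies only the real part, which does not capture
  orthogonality over complex scalars.\<close>

definition cinner :: "l2Z \<Rightarrow> l2Z \<Rightarrow> complex" where
  "cinner x y = (\<Sum>\<^sub>\<infinity>k. l2_coord x k * cnj (l2_coord y k))"

lemma l2_coord_add: "l2_coord (x + y) k = l2_coord x k + l2_coord y k"
  by (simp add: plus_l2Z.rep_eq)

lemma l2_coord_diff: "l2_coord (x - y) k = l2_coord x k - l2_coord y k"
  by (simp add: minus_l2Z.rep_eq)

lemma l2_coord_cscale: "l2_coord (c *\<^sub>C x) k = c * l2_coord x k"
  by (simp add: cscale.rep_eq)

lemma l2_coord_zero: "l2_coord 0 k = 0"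
  by (simp add: zero_l2Z.rep_eq)

lemma l2_coord_sum: "l2_coord (sum f A) k = (\<Sum>a\<in>A. l2_coord (f a) k)"
  by (induction A rule: infinite_finite_induct) (simp_all add: l2_coord_zero l2_coord_add)

lemma l2_coord_eqI: "(\<And>k. l2_coord x k = l2_coord y k) \<Longrightarrow> x = y"
  by (rule l2_coord_inject[THEN iffD1]) (rule ext)

lemma norm_l2Z_power2: "(norm x)\<^sup>2 = (\<Sum>\<^sub>\<infinity>k. (cmod (l2_coord x k))\<^sup>2)"
  by (simp add: norm_l2Z_def infsum_nonneg)

lemma norm_l2Z_has_sum: "((\<lambda>k. (cmod (l2_coord x k))\<^sup>2) has_sum (norm x)\<^sup>2) UNIV"
  using l2_coord[of x] by (simp add: norm_l2Z_power2)

lemma l2_coord_le_norm: "cmod (l2_coord x k) \<le> norm x"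
proof -
  have "(\<Sum>j\<in>{k}. (cmod (l2_coord x j))\<^sup>2) \<le> (norm x)\<^sup>2"
    unfolding norm_l2Z_power2
    by (rule finite_sum_le_infsum) (use l2_coord[of x] in auto)
  then show ?thesis
    using power2_le_imp_le[OF _ norm_ge_zero] by simp
qed

lemma summable_on_square_summable_mult:
  fixes f g :: "int \<Rightarrow> complex"
  assumes "(\<lambda>k. (cmod (f k))\<^sup>2) summable_on UNIV" "(\<lambda>k. (cmod (g k))\<^sup>2) summable_on UNIV"
  shows "(\<lambda>k. f k * cnj (g k)) summable_on UNIV"
proof (rule abs_summable_summable, rule Infinite_Sum.abs_summable_on_comparison_test')
  show "(\<lambda>k. (cmod (f k))\<^sup>2 + (cmod (g k))\<^sup>2) summable_on UNIV"
    by (intro summable_on_add assms)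
  fix k
  have "2 * (cmod (f k) * cmod (g k)) \<le> (cmod (f k))\<^sup>2 + (cmod (g k))\<^sup>2"
    using sum_squares_bound[of "cmod (f k)" "cmod (g k)"] by simp
  moreover have "0 \<le> cmod (f k) * cmod (g k)" by simp
  ultimately show "cmod (f k * cnj (g k)) \<le> (cmod (f k))\<^sup>2 + (cmod (g k))\<^sup>2"
    unfolding norm_mult complex_mod_cnj by linarith
qed

lemma summable_cinner: "(\<lambda>k. l2_coord x k * cnj (l2_coord y k)) summable_on UNIV"
  using l2_coord[of x] l2_coord[of y] by (intro summable_on_square_summable_mult) auto

lemma cinner_add_left: "cinner (x + y) z = cinner x z + cinner y z"
  unfolding cinner_def by (simp add: l2_coord_add distrib_right infsum_add summable_cinner)

lemma cinner_cscale_left: "cinner (c *\<^sub>C x) z = c * cinner x z"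
  unfolding cinner_def by (simp add: l2_coord_cscale mult.assoc infsum_cmult_right')

lemma cinner_zero_left: "cinner 0 z = 0"
  by (simp add: cinner_def l2_coord_zero)

lemma cinner_commute: "cinner x y = cnj (cinner y x)"
  unfolding cinner_def infsum_cnj[symmetric] by (simp add: mult.commute)

lemma cinner_diff_left: "cinner (x - y) z = cinner x z - cinner y z"
  using cinner_add_left[of "x - y" y z] by simp

lemma cinner_sum_left: "cinner (sum f A) z = (\<Sum>a\<in>A. cinner (f a) z)"
  by (induction A rule: infinite_finite_induct) (simp_all add: cinner_zero_left cinner_add_left)

lemma cinner_cscale_right: "cinner x (c *\<^sub>C z) = cnj c * cinner x z"
  using cinner_commute[of x "c *\<^sub>C z"] cinner_commute[of x z] by (simp add: cinner_cscale_left)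

lemma cinner_self: "cinner x x = complex_of_real ((norm x)\<^sup>2)"
proof -
  have "((\<lambda>k. complex_of_real ((cmod (l2_coord x k))\<^sup>2)) has_sum complex_of_real ((norm x)\<^sup>2)) UNIV"
    by (intro has_sum_of_real norm_l2Z_has_sum)
  then show ?thesis
    unfolding cinner_def by (simp add: complex_norm_square[symmetric] infsumI)
qed

text \<open>The class instance gives homogeneity for real scalars only; complex scalars are handled
  through \<open>cinner_self\<close>.\<close>

lemma norm_cscale: "norm (c *\<^sub>C x) = cmod c * norm x"
proof -
  have "complex_of_real ((norm (c *\<^sub>C x))\<^sup>2) = complex_of_real ((cmod c * norm x)\<^sup>2)"
    unfolding cinner_self[symmetric] power_mult_distrib of_real_mult complex_norm_square
    by (simp add: cinner_cscale_left cinner_cscale_right)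
  then have "(norm (c *\<^sub>C x))\<^sup>2 = (cmod c * norm x)\<^sup>2"
    using of_real_eq_iff by blast
  then show ?thesis by (simp add: power2_eq_iff_nonneg)
qed

lemma cinner_span_zero:
  assumes "v \<in> l2Z.span E" "\<And>x. x \<in> E \<Longrightarrow> cinner x e = 0"
  shows "cinner v e = 0"
  using assms(1)
  by (induction rule: l2Z.span_induct_alt)
     (simp_all add: cinner_zero_left cinner_add_left cinner_cscale_left assms(2))

section \<open>Orthonormal sets: Gram-Schmidt and Bessel\<close>

definition orthonormal :: "l2Z set \<Rightarrow> bool" where
  "orthonormal E \<longleftrightarrow> (\<forall>x\<in>E. \<forall>y\<in>E. cinner x y = (if x = y then 1 else 0))"

lemma orthonormalD: "orthonormal E \<Longrightarrow> x \<in> E \<Longrightarrow> y \<in> E \<Longrightarrow> cinner x y = (if x = y then 1 else 0)"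
  by (simp add: orthonormal_def)

lemma orthonormal_norm: "orthonormal E \<Longrightarrow> x \<in> E \<Longrightarrow> norm x = 1"
  using orthonormalD[of E x x] cinner_self[of x] norm_ge_zero[of x]
  by (simp add: power2_eq_1_iff del: of_real_power norm_ge_zero)

text \<open>The new vector is \<open>v\<close> minus its projection onto the span, normalized. That
  it stays in the span of \<open>v\<close> and \<open>E\<close> later lets triangularity of
  \<open>T\<close> at \<open>v\<close> carry over to \<open>e\<close>.\<close>

lemma gram_schmidt:
  assumes "finite E" "orthonormal E" "v \<notin> l2Z.span E"
  obtains e where "norm e = 1" "\<And>x. x \<in> E \<Longrightarrow> cinner x e = 0"
    "e \<in> l2Z.span (insert v E)"
proof -
  define u where "u = (\<Sum>x\<in>E. cinner v x *\<^sub>C x)"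
  define w where "w = v - u"
  define e where "e = complex_of_real (inverse (norm w)) *\<^sub>C w"
  have u: "u \<in> l2Z.span E"
    unfolding u_def by (intro l2Z.span_sum l2Z.span_scale l2Z.span_base)
  with assms have w0: "w \<noteq> 0" by (auto simp: w_def)
  have ortho: "cinner w x = 0" if "x \<in> E" for x
  proof -
    have "cinner u x = (\<Sum>y\<in>E. cinner v y * (if y = x then 1 else 0))"
      unfolding u_def cinner_sum_left cinner_cscale_left
      using that by (intro sum.cong refl) (simp add: orthonormalD[OF assms(2)])
    also have "\<dots> = cinner v x"
      using that assms(1) by (simp add: if_distrib cong: if_cong)
    finally show ?thesis by (simp add: w_def cinner_diff_left)
  qed
  show ?thesis
  proof
    show "norm e = 1" using w0 by (simp add: e_def norm_cscale norm_inverse)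
    show "cinner x e = 0" if "x \<in> E" for x
      using ortho[OF that] cinner_commute[of x w] by (simp add: e_def cinner_cscale_right)
    have "u \<in> l2Z.span (insert v E)"
      using u l2Z.span_mono[of E "insert v E"] by auto
    then show "e \<in> l2Z.span (insert v E)"
      unfolding e_def w_def by (intro l2Z.span_scale l2Z.span_diff[OF l2Z.span_base]) auto
  qed
qed

text \<open>Bessel's inequality for the \<open>k\<close>-th unit vector, whose projection to the span is \<open>v\<close>.\<close>

lemma bessel_coordinate:
  assumes "finite E" "orthonormal E"
  shows "(\<Sum>e\<in>E. (cmod (l2_coord e k))\<^sup>2) \<le> 1"
proof -
  define S where "S = (\<Sum>e\<in>E. (cmod (l2_coord e k))\<^sup>2)"
  define v where "v = (\<Sum>e\<in>E. cnj (l2_coord e k) *\<^sub>C e)"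
  have S: "complex_of_real S = (\<Sum>e\<in>E. l2_coord e k * cnj (l2_coord e k))"
    by (simp add: S_def complex_norm_square del: of_real_power)
  have vk: "l2_coord v k = complex_of_real S"
    by (simp add: v_def l2_coord_sum l2_coord_cscale S mult.commute)
  have ve: "cinner e v = l2_coord e k" if "e \<in> E" for e
  proof -
    have "cinner v e = (\<Sum>x\<in>E. cnj (l2_coord x k) * (if x = e then 1 else 0))"
      unfolding v_def cinner_sum_left cinner_cscale_left
      using that by (intro sum.cong refl) (simp add: orthonormalD[OF assms(2)])
    also have "\<dots> = cnj (l2_coord e k)"
      using that assms(1) by (simp add: if_distrib cong: if_cong)
    finally show ?thesis using cinner_commute[of e v] by simp
  qed
  have "cinner v v = complex_of_real S"
    unfolding S by (subst (1) v_def) (simp add: cinner_sum_left cinner_cscale_left ve mult.commute)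
  then have norm_v: "(norm v)\<^sup>2 = S"
    unfolding cinner_self using of_real_eq_iff by blast
  \<comment> \<open>The \<open>k\<close>-th coordinate of \<open>v\<close> is \<open>S\<close> and
    its squared norm is \<open>S\<close> as well, so bounding a coordinate by the norm is the whole
    inequality.\<close>
  have "S\<^sup>2 \<le> S"
    using power_mono[OF l2_coord_le_norm[of v k], of 2] by (simp add: vk norm_v)
  then show ?thesis
    unfolding S_def[symmetric] by (smt (verit) power2_eq_square mult_le_cancel_left2)
qed

section \<open>Schur triangularization\<close>

text \<open>The elements of \<open>E\<close>, in order of insertion, form an orthonormal basis in which \<open>T\<close> is upper
  triangular with diagonal entries \<open>cinner (T e) e\<close>.\<close>

inductive schur_set :: "(l2Z \<Rightarrow> l2Z) \<Rightarrow> l2Z set \<Rightarrow> bool" for T where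
  empty: "schur_set T {}"
| insert: "schur_set T E \<Longrightarrow> norm e = 1 \<Longrightarrow> (\<And>x. x \<in> E \<Longrightarrow> cinner x e = 0) \<Longrightarrow>
    T e \<in> l2Z.span (insert e E) \<Longrightarrow> schur_set T (insert e E)"

lemma schur_set_finite: "schur_set T E \<Longrightarrow> finite E"
  by (induction rule: schur_set.induct) auto

text \<open>A vector of the span would be orthogonal to itself.\<close>

lemma not_in_span_of_orthogonal:
  assumes "norm e = 1" "\<And>x. x \<in> E \<Longrightarrow> cinner x e = 0"
  shows "e \<notin> l2Z.span E"
  using cinner_span_zero[of e E e] assms cinner_self[of e] by auto

lemma schur_set_orthonormal: "schur_set T E \<Longrightarrow> orthonormal E"
proof (induction rule: schur_set.induct)
  case (insert E e)
  have "cinner e x = 0" if "x \<in> E" for x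
    using cinner_commute[of e x] insert.hyps(3)[OF that] by simp
  moreover have "e \<notin> E"
    using not_in_span_of_orthogonal[OF insert.hyps(2,3)] l2Z.span_base by blast
  ultimately show ?case using insert by (auto simp: orthonormal_def cinner_self)
qed (simp add: orthonormal_def)

lemma schur_set_independent: "schur_set T E \<Longrightarrow> l2Z.independent E"
  by (induction rule: schur_set.induct)
     (simp_all add: l2Z.independent_empty l2Z.independent_insertI not_in_span_of_orthogonal)

lemma cinner_of_triangular:
  assumes "norm e = 1" "\<And>x. x \<in> E \<Longrightarrow> cinner x e = 0" "T e - z *\<^sub>C e \<in> l2Z.span E"
  shows "cinner (T e) e = z"
  using cinner_span_zero[OF assms(3,2)] assms(1)
  by (simp add: cinner_diff_left cinner_cscale_left cinner_self)

section \<open>Invariant spans and root spaces\<close>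

lemma schur_set_span_invariant:
  assumes T: "Vector_Spaces.linear cscale cscale T" and "schur_set T E" "v \<in> l2Z.span E"
  shows "T v \<in> l2Z.span E"
proof -
  interpret T: Vector_Spaces.linear cscale cscale T by fact
  have base: "T e \<in> l2Z.span E" if "e \<in> E" for e
    using assms(2) that
  proof (induction rule: schur_set.induct)
    case (insert E e')
    then show ?case using l2Z.span_mono[of E "insert e' E"] by auto
  qed simp
  show ?thesis
    using assms(3) by (induction rule: l2Z.span_induct_alt)
      (simp_all add: T.add T.scale T.zero l2Z.span_zero l2Z.span_add l2Z.span_scale base)
qed

text \<open>Eigenvalues of a triangular matrix are diagonal entries: if \<open>z\<close> is none of
  them, the coefficient of \<open>v\<close> at the last inserted vector vanishes, and induction
  continues in the smaller span.\<close>

lemma schur_set_no_eigenvector: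
  assumes T: "Vector_Spaces.linear cscale cscale T" and "schur_set T E"
    and "\<And>e. e \<in> E \<Longrightarrow> cinner (T e) e \<noteq> z" "v \<in> l2Z.span E" "T v = z *\<^sub>C v"
  shows "v = 0"
  using assms(2-)
proof (induction arbitrary: v rule: schur_set.induct)
  case (insert E e)
  interpret T: Vector_Spaces.linear cscale cscale T by fact
  obtain c where c: "v - c *\<^sub>C e \<in> l2Z.span E"
    using insert.prems(2) by (auto simp: l2Z.span_insert)
  define w where "w = v - c *\<^sub>C e"
  obtain m where m: "T e - m *\<^sub>C e \<in> l2Z.span E"
    using insert.hyps(4) by (auto simp: l2Z.span_insert)
  have "m \<noteq> z"
    using cinner_of_triangular[where T = T and E = E and e = e and z = m, OF insert.hyps(2,3) m] insert.prems(1) by auto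
  have "T w \<in> l2Z.span E"
    using schur_set_span_invariant[OF T insert.hyps(1)] c by (simp add: w_def)
  \<comment> \<open>Writing \<open>v = w + c e\<close> in \<open>T v = z v\<close> gives
    \<open>z w - T w = c (T e - z e)\<close>. Removing the part of \<open>T e\<close> in the span
    leaves a multiple of \<open>e\<close> that must lie in the span.\<close>
  then have "z *\<^sub>C w - T w - c *\<^sub>C (T e - m *\<^sub>C e) \<in> l2Z.span E"
    using l2Z.span_diff[OF l2Z.span_diff[OF l2Z.span_scale[OF c, of z]] l2Z.span_scale[OF m, of c]]
    by (simp add: w_def)
  moreover have "z *\<^sub>C w - T w - c *\<^sub>C (T e - m *\<^sub>C e) = (c * (m - z)) *\<^sub>C e"
    by (simp add: w_def T.diff T.scale insert.prems(3) l2Z.scale_right_diff_distrib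
        l2Z.scale_left_diff_distrib right_diff_distrib l2Z.scale_scale mult.commute)
  ultimately have in_span: "(c * (m - z)) *\<^sub>C e \<in> l2Z.span E" by simp
  have "c = 0"
  proof (rule ccontr)
    assume "c \<noteq> 0"
    with \<open>m \<noteq> z\<close> have "inverse (c * (m - z)) * (c * (m - z)) = 1"
      by (intro left_inverse) simp
    with l2Z.span_scale[OF in_span, of "inverse (c * (m - z))"]
    have "e \<in> l2Z.span E" by (simp only: l2Z.scale_scale l2Z.scale_one)
    with not_in_span_of_orthogonal[OF insert.hyps(2,3)] show False by blast
  qed
  with c insert.IH[of v] insert.prems show ?case by simp
qed simp

text \<open>The iterates of \<open>T - z\<close> on \<open>u\<close> start outside \<open>V\<close>
  and end at \<open>0\<close>, inside \<open>V\<close>. An iterate just before such an entry serves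
  as \<open>v\<close>; the remaining iterations still annihilate it.\<close>

lemma gen_eigenspace_step:
  assumes "u \<in> gen_eigenspace T z" "u \<notin> V" "0 \<in> V"
  obtains v where "v \<in> gen_eigenspace T z" "v \<notin> V" "T v - z *\<^sub>C v \<in> V"
proof -
  define S where "S = (\<lambda>v. T v - z *\<^sub>C v)"
  obtain n where n: "(S ^^ n) u = 0"
    using assms(1) by (auto simp: gen_eigenspace_def S_def)
  have "\<exists>m<n. (S ^^ m) u \<notin> V \<and> (S ^^ Suc m) u \<in> V"
    using ex_least_nat_less[of "\<lambda>m. (S ^^ m) u \<in> V" n] n assms(2,3)
    by (metis funpow_0 lessI order_refl)
  then obtain m where m: "m < n" "(S ^^ m) u \<notin> V" "(S ^^ Suc m) u \<in> V" by blast
  have "(S ^^ (n - m)) ((S ^^ m) u) = (S ^^ (n - m + m)) u"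
    by (simp only: funpow_add o_apply)
  then have "(S ^^ (n - m)) ((S ^^ m) u) = 0"
    using m(1) n by simp
  with m that[of "(S ^^ m) u"] show ?thesis
    by (auto simp: gen_eigenspace_def S_def)
qed

text \<open>\<open>T - z\<close> maps the span into itself and is injective there, so no power of it
  kills a nonzero vector of the span. This keeps a new root space apart from those already
  treated.\<close>

lemma gen_eigenspace_meets_invariant_trivially:
  assumes T: "Vector_Spaces.linear cscale cscale T" and "schur_set T E"
    and "\<And>e. e \<in> E \<Longrightarrow> cinner (T e) e \<noteq> z"
    and u: "u \<in> l2Z.span E" "u \<in> gen_eigenspace T z"
  shows "u = 0"
proof -
  interpret T: Vector_Spaces.linear cscale cscale T by fact
  define S where "S = (\<lambda>v. T v - z *\<^sub>C v)"
  have "u = 0" if "(S ^^ n) u = 0" "u \<in> l2Z.span E" for n u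
    using that
  proof (induction n arbitrary: u)
    case (Suc n)
    have "S u \<in> l2Z.span E"
      unfolding S_def using Suc.prems(2)
      by (intro l2Z.span_diff l2Z.span_scale schur_set_span_invariant[OF T assms(2)])
    with Suc have "S u = 0" by (simp add: funpow_swap1)
    with schur_set_no_eigenvector[OF T assms(2,3), of u] Suc.prems(2) show ?case
      by (simp add: S_def)
  qed simp
  with u show ?thesis by (auto simp: gen_eigenspace_def S_def)
qed

lemma subspace_gen_eigenspace:
  assumes T: "Vector_Spaces.linear cscale cscale T"
  shows "l2Z.subspace (gen_eigenspace T z)"
proof -
  interpret T: Vector_Spaces.linear cscale cscale T by fact
  define S where "S = (\<lambda>v. T v - z *\<^sub>C v)"
  have zero: "(S ^^ n) 0 = 0" for n
    by (induction n) (simp_all add: S_def T.zero)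
  have add: "(S ^^ n) (x + y) = (S ^^ n) x + (S ^^ n) y" for n x y
    by (induction n) (simp_all add: S_def T.add l2Z.scale_right_distrib)
  have scale: "(S ^^ n) (c *\<^sub>C x) = c *\<^sub>C (S ^^ n) x" for n c x
    by (induction n)
       (simp_all add: S_def T.scale l2Z.scale_right_diff_distrib l2Z.scale_scale mult.commute)
  have more: "(S ^^ (m + n)) x = 0" if "(S ^^ n) x = 0" for m n x
    using that by (simp add: funpow_add zero)
  show ?thesis
    unfolding l2Z.subspace_def gen_eigenspace_def S_def[symmetric]
  proof (intro conjI ballI allI)
    show "0 \<in> {u. \<exists>n. (S ^^ n) u = 0}" using zero by blast
    fix x assume "x \<in> {u. \<exists>n. (S ^^ n) u = 0}"
    then obtain n where n: "(S ^^ n) x = 0" by blast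
    show "c *\<^sub>C x \<in> {u. \<exists>n. (S ^^ n) u = 0}" for c
      using n by (auto simp: scale intro: exI[of _ n])
    fix y assume "y \<in> {u. \<exists>n. (S ^^ n) u = 0}"
    then obtain m where m: "(S ^^ m) y = 0" by blast
    have "(S ^^ (m + n)) (x + y) = 0"
      using more[OF n, of m] more[OF m, of n] by (simp add: add add.commute)
    then show "x + y \<in> {u. \<exists>n. (S ^^ n) u = 0}" by blast
  qed
qed

text \<open>Vectors of \<open>B\<close> join \<open>E\<close> one at a time. If
  \<open>b = x + y\<close> with \<open>x\<close> from earlier vectors and \<open>y\<close> in the
  span of \<open>E\<close>, then \<open>y = b - x\<close> lies in both spans, hence vanishes,
  against independence of \<open>B\<close>.\<close>

lemma independent_Un_trivial_Int:
  assumes "finite B" "l2Z.independent B" "l2Z.independent E" "l2Z.span B \<inter> l2Z.span E = {0}"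
  shows "l2Z.independent (B \<union> E)" "B \<inter> E = {}"
proof -
  have "l2Z.independent (B' \<union> E)" if "B' \<subseteq> B" for B'
    using finite_subset[OF that assms(1)] that
  proof (induction rule: finite_induct)
    case (insert b B')
    have "b \<notin> l2Z.span (B' \<union> E)"
    proof
      assume "b \<in> l2Z.span (B' \<union> E)"
      then obtain x y where xy: "b = x + y" "x \<in> l2Z.span B'" "y \<in> l2Z.span E"
        by (auto simp: l2Z.span_Un)
      then have "y = b - x" by simp
      moreover have "x \<in> l2Z.span B"
        using xy(2) insert.prems l2Z.span_mono[of B' B] by auto
      ultimately have "y \<in> l2Z.span B"
        using insert.prems by (auto intro: l2Z.span_diff l2Z.span_base)
      with xy(3) assms(4) have "y = 0" by blast
      with xy have "b \<in> l2Z.span B'" by simp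
      moreover have "l2Z.independent (insert b B')"
        using insert.prems by (rule l2Z.independent_mono[OF assms(2)])
      ultimately show False using insert.hyps
        by (simp add: l2Z.independent_insert)
    qed
    with insert l2Z.independent_insertI[of b "B' \<union> E"] show ?case by simp
  qed (simp add: assms)
  then show "l2Z.independent (B \<union> E)" by simp
  show "B \<inter> E = {}"
  proof (rule ccontr)
    assume "B \<inter> E \<noteq> {}"
    then obtain x where "x \<in> B" "x \<in> E" by blast
    then have "x = 0" using assms(4) l2Z.span_base by blast
    with \<open>x \<in> B\<close> assms(2) show False using l2Z.dependent_zero by blast
  qed
qed

text \<open>Vectors with diagonal entry \<open>z\<close> are added one by one. As long as fewer than
  \<open>alg_mult T z\<close> are present, a dimension count yields a root vector outside the
  current span.\<close>

lemma schur_set_extend: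
  assumes T: "Vector_Spaces.linear cscale cscale T" and E: "schur_set T E"
    and new: "\<And>e. e \<in> E \<Longrightarrow> cinner (T e) e \<noteq> z" and fin: "finite_alg_mult T z"
  shows "\<exists>D. schur_set T (D \<union> E) \<and> D \<inter> E = {} \<and> card D = alg_mult T z
    \<and> (\<forall>e\<in>D. cinner (T e) e = z)"
proof -
  define G where "G = gen_eigenspace T z"
  obtain B where B: "B \<subseteq> G" "l2Z.independent B" "G \<subseteq> l2Z.span B" "card B = alg_mult T z"
    using l2Z.basis_exists[of G] by (metis G_def alg_mult_def)
  \<comment> \<open>An infinite basis would have \<open>card\<close> equal to \<open>0\<close>;
    finiteness makes \<open>card B\<close> the true dimension.\<close>
  have finB: "finite B"
    using fin B l2Z.independent_span_bound[of _ B] unfolding finite_alg_mult_def G_def by blast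
  have "l2Z.span B \<subseteq> G"
    using B(1) subspace_gen_eigenspace[OF T] unfolding G_def by (rule l2Z.span_minimal)
  then have "l2Z.span B \<inter> l2Z.span E = {0}"
    using gen_eigenspace_meets_invariant_trivially[OF T E new] l2Z.span_zero
    unfolding G_def by blast
  note BE = independent_Un_trivial_Int[OF finB B(2) schur_set_independent[OF E] this]
  have "\<exists>D. schur_set T (D \<union> E) \<and> D \<inter> E = {} \<and> card D = n \<and> (\<forall>e\<in>D. cinner (T e) e = z)"
    if "n \<le> alg_mult T z" for n
    using that
  proof (induction n)
    case (Suc n)
    then obtain D where D: "schur_set T (D \<union> E)" "D \<inter> E = {}" "card D = n"
      "\<forall>e\<in>D. cinner (T e) e = z" by auto
    note finDE = schur_set_finite[OF D(1)]
    \<comment> \<open>Otherwise the independent set \<open>B \<union> E\<close>, of size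
      \<open>alg_mult T z + card E\<close>, would lie in a span of \<open>n + card E\<close> vectors
      with \<open>n < alg_mult T z\<close>.\<close>
    have "\<not> B \<subseteq> l2Z.span (D \<union> E)"
    proof
      assume "B \<subseteq> l2Z.span (D \<union> E)"
      then have "B \<union> E \<subseteq> l2Z.span (D \<union> E)"
        using l2Z.span_superset[of "D \<union> E"] by blast
      then have "card (B \<union> E) \<le> card (D \<union> E)"
        using l2Z.independent_span_bound[OF finDE BE(1)] by blast
      then show False
        using finDE finB BE(2) D(2,3) B(4) Suc.prems by (simp add: card_Un_disjoint)
    qed
    then obtain v where v: "v \<in> G" "v \<notin> l2Z.span (D \<union> E)"
      "T v - z *\<^sub>C v \<in> l2Z.span (D \<union> E)"
      using gen_eigenspace_step[of _ T z "l2Z.span (D \<union> E)"] B(1) l2Z.span_zero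
      unfolding G_def by blast
    obtain e where e: "norm e = 1" "\<And>x. x \<in> D \<union> E \<Longrightarrow> cinner x e = 0"
      "e \<in> l2Z.span (insert v (D \<union> E))"
      using gram_schmidt[OF finDE schur_set_orthonormal[OF D(1)] v(2)] by blast
    interpret T: Vector_Spaces.linear cscale cscale T by fact
    obtain c where c: "e - c *\<^sub>C v \<in> l2Z.span (D \<union> E)"
      using e(3) by (auto simp: l2Z.span_insert)
    define w where "w = e - c *\<^sub>C v"
    \<comment> \<open>Since \<open>e = w + c v\<close> with \<open>w\<close> in the invariant span,
      \<open>T - z\<close> sends \<open>e\<close> into the span, which makes \<open>z\<close> its
      diagonal entry.\<close>
    have "T w - z *\<^sub>C w + c *\<^sub>C (T v - z *\<^sub>C v) \<in> l2Z.span (D \<union> E)"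
      unfolding w_def
      by (intro l2Z.span_add[OF l2Z.span_diff[OF schur_set_span_invariant[OF T D(1) c]
            l2Z.span_scale[OF c]] l2Z.span_scale[OF v(3)]])
    moreover have "T w - z *\<^sub>C w + c *\<^sub>C (T v - z *\<^sub>C v) = T e - z *\<^sub>C e"
      by (simp add: w_def T.diff T.scale l2Z.scale_right_diff_distrib l2Z.scale_scale mult.commute)
    ultimately have Te: "T e - z *\<^sub>C e \<in> l2Z.span (D \<union> E)" by simp
    then have "schur_set T (insert e (D \<union> E))"
      using D(1) e by (intro schur_set.insert) (auto simp: l2Z.span_insert)
    moreover have "e \<notin> D \<union> E"
      using not_in_span_of_orthogonal[OF e(1,2)] l2Z.span_base by blast
    moreover have "cinner (T e) e = z"
      by (rule cinner_of_triangular[where T = T and E = "D \<union> E" and e = e and z = z, OF e(1,2) Te])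
    ultimately show ?case
      using D finDE by (intro exI[of _ "insert e D"]) auto
  qed (use E in \<open>auto intro: exI[of _ "{}"]\<close>)
  then show ?thesis by simp
qed

lemma schur_set_exists:
  fixes f :: "complex \<Rightarrow> ennreal"
  assumes T: "Vector_Spaces.linear cscale cscale T"
    and "finite F" "\<And>z. z \<in> F \<Longrightarrow> finite_alg_mult T z"
  shows "\<exists>E. finite E \<and> orthonormal E \<and>
    (\<Sum>z\<in>F. of_nat (alg_mult T z) * f z) = (\<Sum>e\<in>E. f (cinner (T e) e))"
proof -
  \<comment> \<open>The claim is strengthened by keeping all diagonal entries in \<open>F\<close>,
    so that the next eigenvalue differs from every one of them.\<close>
  have "\<exists>E. schur_set T E \<and> (\<forall>e\<in>E. cinner (T e) e \<in> F) \<and>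
    (\<Sum>z\<in>F. of_nat (alg_mult T z) * f z) = (\<Sum>e\<in>E. f (cinner (T e) e))"
    using assms(2,3)
  proof (induction rule: finite_induct)
    case empty
    show ?case by (rule exI[of _ "{}"]) (simp add: schur_set.empty)
  next
    case (insert z F)
    then obtain E where E: "schur_set T E" "\<forall>e\<in>E. cinner (T e) e \<in> F"
      "(\<Sum>z\<in>F. of_nat (alg_mult T z) * f z) = (\<Sum>e\<in>E. f (cinner (T e) e))" by auto
    have "cinner (T e) e \<noteq> z" if "e \<in> E" for e
      using E(2) that insert.hyps by auto
    then obtain D where D: "schur_set T (D \<union> E)" "D \<inter> E = {}" "card D = alg_mult T z"
      "\<forall>e\<in>D. cinner (T e) e = z"
      using schur_set_extend[OF T E(1), of z] insert.prems by auto
    have "(\<Sum>e\<in>D \<union> E. f (cinner (T e) e)) = (\<Sum>e\<in>D. f z) + (\<Sum>e\<in>E. f (cinner (T e) e))"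
      using schur_set_finite[OF D(1)] D(2,4) by (simp add: sum.union_disjoint)
    with D E insert.hyps show ?case by (intro exI[of _ "D \<union> E"]) auto
  qed
  then show ?thesis using schur_set_finite schur_set_orthonormal by blast
qed

section \<open>Quadratic forms of Jacobi operators\<close>

lemma has_sum_shift:
  fixes f :: "int \<Rightarrow> 'a::{comm_monoid_add,topological_space}"
  assumes "(f has_sum s) UNIV"
  shows "((\<lambda>k. f (k + m)) has_sum s) UNIV"
proof -
  have "bij_betw (\<lambda>k::int. k + m) UNIV UNIV"
    by (rule bij_betwI[where g = "\<lambda>k. k - m"]) auto
  from has_sum_reindex_bij_betw[OF this, of f s] assms show ?thesis by simp
qed

lemma linear_jacobi:
  assumes "bounded (range a)" "bounded (range b)" "bounded (range c)"
  shows "Vector_Spaces.linear cscale cscale (jacobi a b c)"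
proof -
  show ?thesis
    unfolding Vector_Spaces.linear_iff
    by (intro conjI allI l2Z.vector_space_axioms l2_coord_eqI)
       (simp_all add: l2_coord_jacobi[OF assms] l2_coord_add l2_coord_cscale algebra_simps)
qed

text \<open>The two shifts contribute \<open>S\<close> and its conjugate, so the form is twice the
  real part of \<open>S\<close>; the arithmetic-geometric mean inequality gives
  \<open>cmod S \<le> 1\<close>.\<close>

lemma cinner_free_jacobi:
  assumes "norm u = 1"
  shows "cinner (free_jacobi u) u \<in> complex_of_real ` {-2..2}"
proof -
  let ?u = "l2_coord u"
  have sq: "(\<lambda>k. (cmod (?u k))\<^sup>2) summable_on UNIV"
    using l2_coord[of u] by simp
  define S where "S = (\<Sum>\<^sub>\<infinity>k. ?u (k + 1) * cnj (?u k))"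
  have S: "((\<lambda>k. ?u (k + 1) * cnj (?u k)) has_sum S) UNIV"
    unfolding S_def
    by (intro has_sum_infsum summable_on_square_summable_mult sq square_summable_shift)
  have "((\<lambda>k. cnj (?u (k + 1) * cnj (?u k))) has_sum cnj S) UNIV"
    using S by (rule has_sum_cnj_iff[THEN iffD2])
  \<comment> \<open>Conjugation followed by the index shift turns the forward correlation into the
    backward one.\<close>
  from has_sum_shift[OF this, of "- 1"]
  have "((\<lambda>k. ?u (k - 1) * cnj (?u k)) has_sum cnj S) UNIV"
    by (simp add: mult.commute)
  from has_sum_add[OF this S]
  have "((\<lambda>k. l2_coord (free_jacobi u) k * cnj (?u k)) has_sum (cnj S + S)) UNIV"
    by (simp add: free_jacobi_def l2_coord_jacobi distrib_right)
  then have eq: "cinner (free_jacobi u) u = complex_of_real (2 * Re S)"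
    unfolding cinner_def by (simp add: infsumI complex_eq_iff)
  have "((\<lambda>k. (1/2) * ((cmod (?u (k + 1)))\<^sup>2 + (cmod (?u k))\<^sup>2)) has_sum (1/2) * (1 + 1)) UNIV"
    using norm_l2Z_has_sum[of u] assms
    by (intro has_sum_cmult_right has_sum_add has_sum_shift) simp_all
  moreover have "cmod (?u (k + 1) * cnj (?u k))
      \<le> (1/2) * ((cmod (?u (k + 1)))\<^sup>2 + (cmod (?u k))\<^sup>2)" for k
    using sum_squares_bound[of "cmod (?u (k + 1))" "cmod (?u k)"] by (simp add: norm_mult)
  ultimately have "cmod S \<le> (1/2) * (1 + 1)"
    by (rule norm_infsum_le[OF S])
  then have "cmod S \<le> 1" by simp
  then have "\<bar>Re S\<bar> \<le> 1"
    using abs_Re_le_cmod[of S] by linarith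
  then show ?thesis unfolding eq by (intro imageI) auto
qed

section \<open>The perturbation measured by the deviation\<close>

lemma jacobi_deviation_ge:
  "cmod (a (k - 1) - 1) \<le> jacobi_deviation a b c k"
  "cmod (a k - 1) \<le> jacobi_deviation a b c k"
  "cmod (b k) \<le> jacobi_deviation a b c k"
  "cmod (c (k - 1) - 1) \<le> jacobi_deviation a b c k"
  "cmod (c k - 1) \<le> jacobi_deviation a b c k"
  by (simp_all add: jacobi_deviation_def)

lemma jacobi_deviation_nonneg: "0 \<le> jacobi_deviation a b c k"
  using jacobi_deviation_ge(3)[where a = a and b = b and c = c and k = k] norm_ge_zero[of "b k"] by linarith

lemma jacobi_deviation_bounded:
  assumes "bounded (range a)" "bounded (range b)" "bounded (range c)"
  obtains M where "\<And>k. jacobi_deviation a b c k \<le> M"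
proof -
  obtain A B C where bd: "\<And>k. cmod (a k) \<le> A" "\<And>k. cmod (b k) \<le> B" "\<And>k. cmod (c k) \<le> C"
    using assms by (auto simp: bounded_iff)
  have nn: "0 \<le> A" "0 \<le> B" "0 \<le> C"
    using bd order_trans[OF norm_ge_zero] by blast+
  have "cmod (a k - 1) \<le> A + 1" "cmod (c k - 1) \<le> C + 1" for k
    using bd[of k] norm_triangle_ineq4[of "a k" 1] norm_triangle_ineq4[of "c k" 1] by simp_all
  then have le: "cmod (a k - 1) \<le> A + B + C + 1" "cmod (b k) \<le> A + B + C + 1"
    "cmod (c k - 1) \<le> A + B + C + 1" for k
    using bd(2)[of k] nn by (smt (verit))+
  have "jacobi_deviation a b c k \<le> A + B + C + 1" for k
    by (simp add: jacobi_deviation_def le)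
  then show ?thesis by (rule that)
qed

text \<open>A real \<open>infsum\<close> without summability is \<open>0\<close> by default. Bounded
  weights make the sums below genuine even when the deviation is not in the \<open>p\<close>-th
  sequence space.\<close>

lemma weighted_square_summable:
  fixes w :: "int \<Rightarrow> real"
  assumes "\<And>k. 0 \<le> w k" "\<And>k. w k \<le> M"
  shows "(\<lambda>k. w k * (cmod (l2_coord u k))\<^sup>2) summable_on UNIV"
proof (rule summable_on_comparison_test)
  show "(\<lambda>k. M * (cmod (l2_coord u k))\<^sup>2) summable_on UNIV"
    using l2_coord[of u] by (intro summable_on_cmult_right) simp
qed (simp_all add: assms mult_right_mono)

text \<open>The factor \<open>3\<close> counts the diagonal and the two off-diagonals: after
  symmetric splitting and index shifts, each contributes at most one copy of the weighted
  sum.\<close>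

lemma cinner_jacobi_deviation:
  assumes "bounded (range a)" "bounded (range b)" "bounded (range c)"
  shows "cmod (cinner (jacobi a b c u - free_jacobi u) u)
    \<le> 3 * (\<Sum>\<^sub>\<infinity>k. jacobi_deviation a b c k * (cmod (l2_coord u k))\<^sup>2)"
proof -
  let ?u = "l2_coord u"
  define d where "d = jacobi_deviation a b c"
  define g where "g k = d k * (cmod (?u k))\<^sup>2" for k
  note ge = jacobi_deviation_ge[where a = a and b = b and c = c, folded d_def]
  obtain M where "\<And>k. d k \<le> M"
    unfolding d_def using jacobi_deviation_bounded[OF assms] by blast
  then have "g summable_on UNIV"
    unfolding g_def using jacobi_deviation_nonneg[of a b c]
    by (intro weighted_square_summable) (auto simp: d_def)
  then have g: "(g has_sum infsum g UNIV) UNIV" by simp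
  \<comment> \<open>An off-diagonal entry couples two neighbouring indices and is dominated by the
    deviation at both, which is why the maximum includes both \<open>k - 1\<close> and
    \<open>k\<close>. So each square can carry the weight of its own index.\<close>
  have cross: "s * (x * y) \<le> (1/2) * (p * x\<^sup>2 + q * y\<^sup>2)"
    if "0 \<le> s" "s \<le> p" "s \<le> q" "0 \<le> x" "0 \<le> y" for s x y p q :: real
  proof -
    have "s * (x * y) \<le> (1/2) * (s * x\<^sup>2 + s * y\<^sup>2)"
      using mult_left_mono[OF sum_squares_bound[of x y] that(1)] by (simp add: algebra_simps)
    also have "\<dots> \<le> (1/2) * (p * x\<^sup>2 + q * y\<^sup>2)"
      using that by (intro mult_left_mono add_mono mult_right_mono) auto
    finally show ?thesis .
  qed
  have bound: "cmod (l2_coord (jacobi a b c u - free_jacobi u) k * cnj (?u k))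
      \<le> (1/2) * (g (k + - 1) + g k) + g k + (1/2) * (g (k + 1) + g k)" for k
  proof -
    have "l2_coord (jacobi a b c u - free_jacobi u) k * cnj (?u k) =
        (a (k - 1) - 1) * (?u (k - 1) * cnj (?u k)) + b k * (?u k * cnj (?u k)) +
        (c k - 1) * (?u (k + 1) * cnj (?u k))"
      by (simp add: free_jacobi_def l2_coord_diff l2_coord_jacobi assms algebra_simps)
    also have "cmod \<dots> \<le> cmod (a (k - 1) - 1) * (cmod (?u (k - 1)) * cmod (?u k)) +
        cmod (b k) * (cmod (?u k) * cmod (?u k)) +
        cmod (c k - 1) * (cmod (?u (k + 1)) * cmod (?u k))"
      by (intro order_trans[OF norm_triangle_ineq] add_mono) (simp_all add: norm_mult)
    also have "\<dots> \<le> (1/2) * (g (k - 1) + g k) + g k + (1/2) * (g (k + 1) + g k)"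
    proof (intro add_mono)
      show "cmod (a (k - 1) - 1) * (cmod (?u (k - 1)) * cmod (?u k)) \<le> (1/2) * (g (k - 1) + g k)"
        unfolding g_def using ge(1)[of k] ge(2)[of "k - 1"] by (intro cross) auto
      show "cmod (b k) * (cmod (?u k) * cmod (?u k)) \<le> g k"
        unfolding g_def power2_eq_square using ge(3)[of k] by (intro mult_right_mono) auto
      show "cmod (c k - 1) * (cmod (?u (k + 1)) * cmod (?u k)) \<le> (1/2) * (g (k + 1) + g k)"
        unfolding g_def using ge(4)[of "k + 1"] ge(5)[of k] by (intro cross) auto
    qed
    finally show ?thesis by simp
  qed
  have "((\<lambda>k. (1/2) * (g (k + - 1) + g k) + g k + (1/2) * (g (k + 1) + g k)) has_sum
      ((1/2) * (infsum g UNIV + infsum g UNIV) + infsum g UNIV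
        + (1/2) * (infsum g UNIV + infsum g UNIV))) UNIV"
    by (intro has_sum_cmult_right has_sum_add has_sum_shift g)
  from norm_infsum_le[OF has_sum_infsum[OF summable_cinner] this bound]
  show ?thesis
    unfolding cinner_def[symmetric] by (simp add: g_def[abs_def] d_def)
qed

section \<open>Summation of the eigenvalue distances\<close>

text \<open>Jensen's inequality, by summing Young's inequality
  \<open>m powr (p - 1) * x \<le> x powr p / p + (1 - 1 / p) * m powr p\<close> at the mean \<open>m\<close>.\<close>

lemma powr_mean_le:
  fixes x w :: "'a \<Rightarrow> real"
  assumes p: "1 \<le> p" and x: "\<And>k. 0 \<le> x k" and w: "\<And>k. 0 \<le> w k" "(w has_sum 1) A"
    and xw: "(\<lambda>k. x k * w k) summable_on A" and xpw: "(\<lambda>k. x k powr p * w k) summable_on A"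
  shows "(\<Sum>\<^sub>\<infinity>k\<in>A. x k * w k) powr p \<le> (\<Sum>\<^sub>\<infinity>k\<in>A. x k powr p * w k)"
proof -
  define m where "m = (\<Sum>\<^sub>\<infinity>k\<in>A. x k * w k)"
  define S where "S = (\<Sum>\<^sub>\<infinity>k\<in>A. x k powr p * w k)"
  have m0: "0 \<le> m" unfolding m_def by (intro infsum_nonneg) (simp add: x w)
  have S0: "0 \<le> S" unfolding S_def by (intro infsum_nonneg) (simp add: w)
  show ?thesis
  \<comment> \<open>For mean \<open>0\<close> the left side is \<open>0 powr p = 0\<close>; Young's
    inequality is applied to positive numbers only.\<close>
  proof (cases "m = 0")
    case False
    with m0 have m: "0 < m" by simp
    have young: "m powr (p - 1) * x k \<le> (1/p) * x k powr p + (1 - 1/p) * m powr p" for k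
    proof (cases "x k = 0")
      case False
      with x[of k] have xk: "0 < x k" by simp
      have "(x k powr p) powr (1/p) * (m powr p) powr (1 - 1/p)
          \<le> (1/p) * x k powr p + (1 - 1/p) * m powr p"
        using p xk m by (intro Youngs_inequality_0) auto
      moreover have "(m powr p) powr (1 - 1/p) = m powr (p - 1)"
        using p by (simp add: powr_powr right_diff_distrib)
      ultimately show ?thesis
        using p xk by (simp add: powr_powr mult.commute)
    qed (use p in simp)
    have "m powr (p - 1) * m \<le> (1/p) * S + (1 - 1/p) * m powr p * 1"
    proof (rule has_sum_mono)
      show "((\<lambda>k. m powr (p - 1) * (x k * w k)) has_sum m powr (p - 1) * m) A"
        unfolding m_def by (intro has_sum_cmult_right has_sum_infsum xw)
      show "((\<lambda>k. (1/p) * (x k powr p * w k) + (1 - 1/p) * m powr p * w k) has_sum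
          ((1/p) * S + (1 - 1/p) * m powr p * 1)) A"
        unfolding S_def by (intro has_sum_add has_sum_cmult_right has_sum_infsum xpw w)
      show "m powr (p - 1) * (x k * w k)
          \<le> (1/p) * (x k powr p * w k) + (1 - 1/p) * m powr p * w k" for k
        using mult_right_mono[OF young[of k] w(1)[of k]] by (simp add: algebra_simps)
    qed
    moreover have "m powr (p - 1) * m = m powr p"
      using m powr_add[of m "p - 1" 1] by simp
    \<comment> \<open>The weights have total mass \<open>1\<close>, so the term
      \<open>(1 - 1/p) * m powr p\<close> survives summation unchanged and is subtracted from the
      left.\<close>
    ultimately have "(1/p) * m powr p \<le> (1/p) * S" by (simp add: algebra_simps)
    then show ?thesis using p by (simp add: m_def S_def divide_le_cancel)
  qed (use S0 in \<open>simp add: m_def S_def\<close>)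
qed

section \<open>From single unit vectors to orthonormal sets\<close>

lemma has_sum_finite_sum:
  fixes f :: "'a \<Rightarrow> 'b \<Rightarrow> 'c::topological_comm_monoid_add"
  assumes "\<And>i. i \<in> I \<Longrightarrow> (f i has_sum s i) A"
  shows "((\<lambda>k. \<Sum>i\<in>I. f i k) has_sum (\<Sum>i\<in>I. s i)) A"
  using assms by (induction I rule: infinite_finite_induct) (auto intro: has_sum_add)

lemma ennreal_infsum:
  fixes f :: "'a \<Rightarrow> real"
  assumes "f summable_on A" "\<And>k. 0 \<le> f k"
  shows "ennreal (infsum f A) = (\<Sum>\<^sub>\<infinity>k\<in>A. ennreal (f k))"
  using assms
  by (simp add: infsum_nonneg_is_SUPREMUM_ennreal nonneg_infsum_complete sum_ennreal)

text \<open>Valid for any unit vector, hence for Schur vectors, which replace the possibly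
  non-orthogonal root vectors of \<open>J\<close>.\<close>

lemma jacobi_eigenvalue_distance:
  assumes p: "1 \<le> p" and bd: "bounded (range a)" "bounded (range b)" "bounded (range c)"
    and u: "norm u = 1"
  shows "infdist (cinner (jacobi a b c u) u) (complex_of_real ` {-2..2}) powr p
    \<le> 3 powr p * (\<Sum>\<^sub>\<infinity>k. jacobi_deviation a b c k powr p * (cmod (l2_coord u k))\<^sup>2)"
proof -
  define d where "d = jacobi_deviation a b c"
  have d0: "0 \<le> d k" for k by (simp add: d_def jacobi_deviation_nonneg)
  obtain M where M: "\<And>k. d k \<le> M"
    unfolding d_def using jacobi_deviation_bounded[OF bd] by blast
  have "infdist (cinner (jacobi a b c u) u) (complex_of_real ` {-2..2})
      \<le> dist (cinner (jacobi a b c u) u) (cinner (free_jacobi u) u)"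
    by (intro infdist_le cinner_free_jacobi u)
  also have "\<dots> \<le> 3 * (\<Sum>\<^sub>\<infinity>k. d k * (cmod (l2_coord u k))\<^sup>2)"
    using cinner_jacobi_deviation[OF bd] by (simp add: dist_norm cinner_diff_left d_def)
  finally have "infdist (cinner (jacobi a b c u) u) (complex_of_real ` {-2..2}) powr p
      \<le> (3 * (\<Sum>\<^sub>\<infinity>k. d k * (cmod (l2_coord u k))\<^sup>2)) powr p"
    using p by (intro powr_mono2) (auto simp: infdist_nonneg)
  also have "\<dots> = 3 powr p * (\<Sum>\<^sub>\<infinity>k. d k * (cmod (l2_coord u k))\<^sup>2) powr p"
    by (rule powr_mult)
  also have "\<dots> \<le> 3 powr p * (\<Sum>\<^sub>\<infinity>k. d k powr p * (cmod (l2_coord u k))\<^sup>2)"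
  proof (intro mult_left_mono powr_mean_le)
    show "((\<lambda>k. (cmod (l2_coord u k))\<^sup>2) has_sum 1) UNIV"
      using norm_l2Z_has_sum[of u] u by simp
    show "(\<lambda>k. d k * (cmod (l2_coord u k))\<^sup>2) summable_on UNIV"
      by (rule weighted_square_summable[OF d0 M])
    show "(\<lambda>k. d k powr p * (cmod (l2_coord u k))\<^sup>2) summable_on UNIV"
      using p by (intro weighted_square_summable[of _ "M powr p"] powr_mono2 d0 M) auto
  qed (use p d0 in auto)
  finally show ?thesis by (simp add: d_def)
qed

lemma jacobi_orthonormal_distance_sum:
  assumes p: "1 \<le> p" and bd: "bounded (range a)" "bounded (range b)" "bounded (range c)"
    and E: "finite E" "orthonormal E"
  shows "(\<Sum>e\<in>E. ennreal (infdist (cinner (jacobi a b c e) e) (complex_of_real ` {-2..2}) powr p))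
    \<le> ennreal (3 powr p) * (\<Sum>\<^sub>\<infinity>k. ennreal (jacobi_deviation a b c k powr p))"
proof -
  define d where "d k = jacobi_deviation a b c k powr p" for k
  obtain M where M: "\<And>k. jacobi_deviation a b c k \<le> M"
    using jacobi_deviation_bounded[OF bd] by blast
  have d0: "0 \<le> d k" for k by (simp add: d_def)
  have sm: "(\<lambda>k. d k * (cmod (l2_coord e k))\<^sup>2) summable_on UNIV" for e
    unfolding d_def
    using p by (intro weighted_square_summable[of _ "M powr p"] powr_mono2 M)
      (auto simp: jacobi_deviation_nonneg)
  have hs: "((\<lambda>k. \<Sum>e\<in>E. d k * (cmod (l2_coord e k))\<^sup>2) has_sum
      (\<Sum>e\<in>E. \<Sum>\<^sub>\<infinity>k. d k * (cmod (l2_coord e k))\<^sup>2)) UNIV"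
    by (intro has_sum_finite_sum has_sum_infsum sm)
  have "(\<Sum>e\<in>E. ennreal (infdist (cinner (jacobi a b c e) e) (complex_of_real ` {-2..2}) powr p))
      = ennreal (\<Sum>e\<in>E. infdist (cinner (jacobi a b c e) e) (complex_of_real ` {-2..2}) powr p)"
    by (simp add: sum_ennreal)
  also have "\<dots> \<le> ennreal (\<Sum>e\<in>E. 3 powr p * (\<Sum>\<^sub>\<infinity>k. d k * (cmod (l2_coord e k))\<^sup>2))"
    unfolding d_def
    by (intro ennreal_leI sum_mono jacobi_eigenvalue_distance[OF p bd] orthonormal_norm[OF E(2)])
  also have "(\<Sum>e\<in>E. 3 powr p * (\<Sum>\<^sub>\<infinity>k. d k * (cmod (l2_coord e k))\<^sup>2))
      = 3 powr p * (\<Sum>\<^sub>\<infinity>k. \<Sum>e\<in>E. d k * (cmod (l2_coord e k))\<^sup>2)"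
    using infsumI[OF hs] by (simp add: sum_distrib_left)
  also have "ennreal \<dots> = ennreal (3 powr p) * (\<Sum>\<^sub>\<infinity>k. ennreal (\<Sum>e\<in>E. d k * (cmod (l2_coord e k))\<^sup>2))"
    by (subst ennreal_infsum[symmetric])
       (auto simp: d0 intro!: has_sum_imp_summable[OF hs] sum_nonneg ennreal_mult' infsum_nonneg)
  \<comment> \<open>With the finite sum moved inside the series, Bessel's inequality applies at each
    \<open>k\<close>. The right side may be infinite, hence the earlier passage to
    \<open>ennreal\<close>.\<close>
  also have "\<dots> \<le> ennreal (3 powr p) * (\<Sum>\<^sub>\<infinity>k. ennreal (d k))"
  proof (intro mult_left_mono infsum_mono ennreal_leI)
    show "(\<Sum>e\<in>E. d k * (cmod (l2_coord e k))\<^sup>2) \<le> d k" for k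
      unfolding sum_distrib_left[symmetric]
      using mult_left_mono[OF bessel_coordinate[OF E, of k] d0[of k]] by simp
  qed (auto intro: nonneg_summable_on_complete)
  finally show ?thesis by (simp add: d_def)
qed

theorem theorem4p2:
  fixes p :: real
  assumes "p \<ge> 1"
  shows "\<exists>C::real. 0 \<le> C \<and>
    (\<forall>a b c :: int \<Rightarrow> complex.
       bounded (range a) \<longrightarrow> bounded (range b) \<longrightarrow> bounded (range c) \<longrightarrow>
       compact_operator (\<lambda>u. jacobi a b c u - free_jacobi u) \<longrightarrow>
       (\<Sum>\<^sub>\<infinity>z\<in>discrete_spectrum (jacobi a b c).
          of_nat (alg_mult (jacobi a b c) z)
            * ennreal (infdist z (complex_of_real ` {-2..2}) powr p))
       \<le> ennreal C * (\<Sum>\<^sub>\<infinity>k. ennreal (jacobi_deviation a b c k powr p)))"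
proof (intro exI[of _ "3 powr p"] conjI allI impI)
  fix a b c :: "int \<Rightarrow> complex"
  assume bd: "bounded (range a)" "bounded (range b)" "bounded (range c)"
  let ?f = "\<lambda>z. ennreal (infdist z (complex_of_real ` {-2..2}) powr p)"
  let ?R = "ennreal (3 powr p) * (\<Sum>\<^sub>\<infinity>k. ennreal (jacobi_deviation a b c k powr p))"
  \<comment> \<open>A nonnegative extended sum is the supremum of its finite partial sums, so a
    bound uniform in finite sets \<open>F\<close> of eigenvalues suffices.\<close>
  have "(\<Sum>z\<in>F. of_nat (alg_mult (jacobi a b c) z) * ?f z) \<le> ?R"
    if F: "finite F" "F \<subseteq> discrete_spectrum (jacobi a b c)" for F
  proof -
    have "\<And>z. z \<in> F \<Longrightarrow> finite_alg_mult (jacobi a b c) z"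
      using F(2) by (auto simp: discrete_spectrum_def)
    from schur_set_exists[OF linear_jacobi[OF bd] F(1) this, of ?f]
    show ?thesis
      using jacobi_orthonormal_distance_sum[OF assms bd] by auto
  qed
  then show "(\<Sum>\<^sub>\<infinity>z\<in>discrete_spectrum (jacobi a b c).
      of_nat (alg_mult (jacobi a b c) z) * ?f z) \<le> ?R"
    by (subst nonneg_infsum_complete) (auto intro!: SUP_least)
qed simp

end
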